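(* Let $P(7,1)$ be the graph with vertex set $\{u_0,\dots,u_6,v_0,\dots,v_6\}$ and edges $u_iu_{i+1}$, $v_iv_{i+1}$, $u_iv_i$ ($i=0,\dots,6$, indices mod $7$). Every matching of $P(7,1)$ of size five, regarded as a signature, is switching equivalent to a matching of $P(7,1)$ of size at most $4$.
   Context: A matching of size $k$ is a set of $k$ pairwise vertex-disjoint edges. A signature of a graph $G$ is a subset $\Sigma\subseteq E(G)$ (the negative edges). Resigning at a vertex $v$ replaces $\Sigma$ by its symmetric difference with the set of edges incident with $v$; two signatures are switching equivalent if one is obtained from the other by a sequence of resignings. *)

theory Defs
  imports Main
begin

text \<open>
  A graph is a pair of a vertex set and an edge set; an edge is the two-element set of its ends.
\<close>

type_synonym 'a graph = "'a set \<times> 'a set set"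

abbreviation verts :: "'a graph \<Rightarrow> 'a set" where
  "verts G \<equiv> fst G"

abbreviation edges :: "'a graph \<Rightarrow> 'a set set" where
  "edges G \<equiv> snd G"

definition matching_of_size :: "'a graph \<Rightarrow> nat \<Rightarrow> 'a set set \<Rightarrow> bool" where
  "matching_of_size G k M \<longleftrightarrow>
     M \<subseteq> edges G \<and> finite M \<and> card M = k \<and> pairwise disjnt M"

definition signature :: "'a graph \<Rightarrow> 'a set set \<Rightarrow> bool" where
  "signature G \<Sigma> \<longleftrightarrow> \<Sigma> \<subseteq> edges G"

definition resign :: "'a graph \<Rightarrow> 'a \<Rightarrow> 'a set set \<Rightarrow> 'a set set" where
  "resign G v \<Sigma> = sym_diff \<Sigma> {e \<in> edges G. v \<in> e}"

definition resigning :: "'a graph \<Rightarrow> 'a set set \<Rightarrow> 'a set set \<Rightarrow> bool" where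
  "resigning G \<Sigma> \<Sigma>' \<longleftrightarrow> (\<exists>v \<in> verts G. \<Sigma>' = resign G v \<Sigma>)"

text \<open>The sequence of resignings may be empty.\<close>

definition switching_equivalent :: "'a graph \<Rightarrow> 'a set set \<Rightarrow> 'a set set \<Rightarrow> bool" where
  "switching_equivalent G \<Sigma> \<Sigma>' \<longleftrightarrow>
     signature G \<Sigma> \<and> signature G \<Sigma>' \<and> (resigning G)\<^sup>*\<^sup>* \<Sigma> \<Sigma>'"

datatype vertex = U nat | V nat

definition P71 :: "vertex graph" where
  "P71 =
     ({U i | i. i < 7} \<union> {V i | i. i < 7},
      {{U i, U ((i + 1) mod 7)} | i. i < 7} \<union>
      {{V i, V ((i + 1) mod 7)} | i. i < 7} \<union>
      {{U i, V i} | i. i < 7})"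

end

theory Submission
  imports Defs
begin

text \<open>
  Resigning at all vertices of a set \<open>X\<close> flips exactly the edges with one end in \<open>X\<close>. Read a
  signature of the prism as a cyclic word of seven columns. A signature is a matching iff cyclically
  adjacent columns are compatible, and both this and the effect of switching commute with rotation.
  Hence it suffices to treat the 5-matchings whose first column is maximal for a suitable weight;
  there are 229 of them, and for each one of 29 explicit sets \<open>X\<close> yields a matching of size at most 4.
\<close>

section \<open>Resigning at a set of vertices\<close>

text \<open>Resigning at one more vertex \<open>v\<close> toggles exactly the edges containing
  \<open>v\<close>, and these are the edges whose number of ends in the set changes parity.\<close>

lemma switch_set:
  assumes "finite X" "X \<subseteq> verts G"
  shows "(resigning G)\<^sup>*\<^sup>* \<Sigma> (sym_diff \<Sigma> {e \<in> edges G. odd (card (e \<inter> X))})"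
  using assms
proof (induction X rule: finite_induct)
  case empty
  then show ?case by simp
next
  case (insert v X)
  have "odd (card (e \<inter> insert v X)) \<longleftrightarrow> (v \<in> e) \<noteq> odd (card (e \<inter> X))" for e
    using insert.hyps by (cases "v \<in> e") auto
  then have "sym_diff \<Sigma> {e \<in> edges G. odd (card (e \<inter> insert v X))} =
      resign G v (sym_diff \<Sigma> {e \<in> edges G. odd (card (e \<inter> X))})"
    unfolding resign_def by blast
  then have "resigning G (sym_diff \<Sigma> {e \<in> edges G. odd (card (e \<inter> X))})
      (sym_diff \<Sigma> {e \<in> edges G. odd (card (e \<inter> insert v X))})"
    using insert.prems unfolding resigning_def by auto
  with insert show ?case by (auto intro: rtranclp.rtrancl_into_rtrancl)
qed

lemma odd_card_doubleton_Int:
  assumes "x \<noteq> y"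
  shows "odd (card ({x, y} \<inter> X)) \<longleftrightarrow> (x \<in> X) \<noteq> (y \<in> X)"
  using assms by (cases "x \<in> X"; cases "y \<in> X") auto

section \<open>Signatures as cyclic words of columns\<close>

type_synonym column = "bool \<times> bool \<times> bool"

definition columns :: "vertex set set \<Rightarrow> column list" where
  "columns M = map (\<lambda>i. ({U i, U ((i + 1) mod 7)} \<in> M, {V i, V ((i + 1) mod 7)} \<in> M, {U i, V i} \<in> M)) [0..<7]"

text \<open>These are the conflicts at the two vertices of the second column. Rim edges run forward
  into the next column while a spoke stays in its own, hence the asymmetry.\<close>

definition compatible :: "column \<Rightarrow> column \<Rightarrow> bool" where
  "compatible = (\<lambda>(a, b, s) (a', b', s').
     \<not> (a \<and> a') \<and> \<not> (b \<and> b') \<and> \<not> (s' \<and> (a \<or> b \<or> a' \<or> b')))"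

definition cyclic_compatible :: "column list \<Rightarrow> bool" where
  "cyclic_compatible cs = successively compatible (cs @ [hd cs])"

definition column_size :: "column \<Rightarrow> nat" where
  "column_size = (\<lambda>(a, b, s). of_bool a + of_bool b + of_bool s)"

definition total_size :: "column list \<Rightarrow> nat" where
  "total_size cs = sum_list (map column_size cs)"

text \<open>Entry i of \<open>xs\<close> tells whether \<open>U i\<close> and \<open>V i\<close> are
  among the resigned vertices.\<close>

definition switch :: "(bool \<times> bool) list \<Rightarrow> column list \<Rightarrow> column list" where
  "switch xs cs = map (\<lambda>(((x, y), (x', y')), (a, b, s)). (a \<noteq> (x \<noteq> x'), b \<noteq> (y \<noteq> y'), s \<noteq> (x \<noteq> y)))
     (zip (zip xs (rotate1 xs)) cs)"

text \<open>
  Written with \<open>if\<close> instead of \<open>\<and>\<close>, and below with \<open>find\<close> instead of \<open>\<exists>\<close>: evaluation by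
  rewriting is lazy only in the branches of \<open>if\<close>.
\<close>

definition reduced_by :: "column list \<Rightarrow> (bool \<times> bool) list \<Rightarrow> bool" where
  "reduced_by cs xs \<longleftrightarrow> (if cyclic_compatible (switch xs cs) then total_size (switch xs cs) \<le> 4 else False)"

definition reducible :: "column list \<Rightarrow> bool" where
  "reducible cs \<longleftrightarrow> (\<exists>xs. length xs = length cs \<and> reduced_by cs xs)"

section \<open>Matchings of the prism as compatible words\<close>

lemma edges_P71:
  "edges P71 = (\<lambda>i. {U i, U ((i + 1) mod 7)}) ` {..<7} \<union> (\<lambda>i. {V i, V ((i + 1) mod 7)}) ` {..<7}
    \<union> (\<lambda>i. {U i, V i}) ` {..<7}"
  by (auto simp: P71_def)

lemma length_columns [simp]: "length (columns M) = 7"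
  by (simp add: columns_def)

lemma nth_columns:
  "i < 7 \<Longrightarrow> columns M ! i = ({U i, U ((i + 1) mod 7)} \<in> M, {V i, V ((i + 1) mod 7)} \<in> M, {U i, V i} \<in> M)"
  by (simp add: columns_def)

text \<open>The prism is cubic: all edges at a vertex are recorded in its own column or the
  preceding one. Hence compatibility of neighbouring columns controls every vertex.\<close>

lemma incident_edges_P71:
  assumes "e \<in> edges P71"
  shows "U i \<in> e \<Longrightarrow> i < 7 \<and> (e = {U i, U ((i + 1) mod 7)} \<or> e = {U ((i + 6) mod 7), U i} \<or> e = {U i, V i})"
    and "V i \<in> e \<Longrightarrow> i < 7 \<and> (e = {V i, V ((i + 1) mod 7)} \<or> e = {V ((i + 6) mod 7), V i} \<or> e = {U i, V i})"
proof -
  \<comment> \<open>Adding 6 is stepping back by 1 modulo 7, without truncated subtraction.\<close>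
  have pred: "((k + 1) mod 7 + 6) mod 7 = k" if "k < 7" for k :: nat
    using that by presburger
  show "U i \<in> e \<Longrightarrow> i < 7 \<and> (e = {U i, U ((i + 1) mod 7)} \<or> e = {U ((i + 6) mod 7), U i} \<or> e = {U i, V i})"
    using assms pred unfolding edges_P71 by fastforce
  show "V i \<in> e \<Longrightarrow> i < 7 \<and> (e = {V i, V ((i + 1) mod 7)} \<or> e = {V ((i + 6) mod 7), V i} \<or> e = {U i, V i})"
    using assms pred unfolding edges_P71 by fastforce
qed

lemma cyclic_compatible_columns:
  "cyclic_compatible (columns N) \<longleftrightarrow> (\<forall>i<7. compatible (columns N ! i) (columns N ! ((i + 1) mod 7)))"
proof -
  \<comment> \<open>The appended head makes position 7 stand for column 0, which closes the
    cycle.\<close>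
  have "(columns N @ [hd (columns N)]) ! Suc i = columns N ! ((i + 1) mod 7)" if "i < 7" for i
    using that by (cases "i = 6") (auto simp: nth_append hd_conv_nth simp flip: length_0_conv)
  then show ?thesis
    by (simp add: cyclic_compatible_def successively_conv_nth nth_append)
qed

lemma pairwise_disjnt_iff:
  assumes "N \<subseteq> edges P71"
  shows "pairwise disjnt N \<longleftrightarrow> cyclic_compatible (columns N)"
proof
  assume "pairwise disjnt N"
  then have d: "e \<in> N \<Longrightarrow> f \<in> N \<Longrightarrow> e = f \<or> e \<inter> f = {}" for e f
    by (auto simp: pairwise_def disjnt_def)
  have "compatible (columns N ! i) (columns N ! j)" if "i < 7" "j = (i + 1) mod 7" for i j
  proof -
    \<comment> \<open>As the cycle is longer than 2, consecutive rim edges are distinct, so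
      \<open>d\<close> forbids both to lie in \<open>N\<close>.\<close>
    have n: "j < 7" "i \<noteq> j" "i \<noteq> (j + 1) mod 7" using that by (auto simp: mod_if split: if_splits)
    show ?thesis
      using that d[of "{U i, U j}" "{U j, U ((j + 1) mod 7)}"] d[of "{V i, V j}" "{V j, V ((j + 1) mod 7)}"]
        d[of "{U i, U j}" "{U j, V j}"] d[of "{V i, V j}" "{U j, V j}"]
        d[of "{U j, U ((j + 1) mod 7)}" "{U j, V j}"] d[of "{V j, V ((j + 1) mod 7)}" "{U j, V j}"] n
      by (auto simp: nth_columns compatible_def doubleton_eq_iff)
  qed
  then show "cyclic_compatible (columns N)" by (simp add: cyclic_compatible_columns)
next
  assume c: "cyclic_compatible (columns N)"
  have "e = f" if e: "e \<in> N" "v \<in> e" and f: "f \<in> N" "v \<in> f" for e f v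
  proof -
    have cc: "compatible (columns N ! ((i + 6) mod 7)) (columns N ! i)" if "i < 7" for i
    proof -
      have "((i + 6) mod 7 + 1) mod 7 = i" using that by presburger
      moreover have "(i + 6) mod 7 < 7" by simp
      ultimately show ?thesis using c by (metis cyclic_compatible_columns)
    qed
    have ef: "e \<in> edges P71" "f \<in> edges P71" using assms e f by auto
    show ?thesis
    proof (cases v)
      case (U i)
      have i: "i < 7" using incident_edges_P71(1)[OF ef(1)] e U by blast
      then have "((i + 6) mod 7 + 1) mod 7 = i" by presburger
      with U show ?thesis using incident_edges_P71(1)[OF ef(1)] incident_edges_P71(1)[OF ef(2)] e f cc[OF i] i
        by (auto simp: nth_columns compatible_def)
    next
      case (V i)
      have i: "i < 7" using incident_edges_P71(2)[OF ef(1)] e V by blast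
      then have "((i + 6) mod 7 + 1) mod 7 = i" by presburger
      with V show ?thesis using incident_edges_P71(2)[OF ef(1)] incident_edges_P71(2)[OF ef(2)] e f cc[OF i] i
        by (auto simp: nth_columns compatible_def)
    qed
  qed
  then show "pairwise disjnt N" unfolding pairwise_def disjnt_def by blast
qed

text \<open>The two rims and the spokes are disjoint families, each indexed injectively by the
  columns, so counting the true bits counts the edges.\<close>

lemma matching_of_size_iff:
  assumes "N \<subseteq> edges P71"
  shows "matching_of_size P71 k N \<longleftrightarrow> cyclic_compatible (columns N) \<and> total_size (columns N) = k"
proof -
  let ?u = "\<lambda>i. {U i, U ((i + 1) mod 7)}" and ?v = "\<lambda>i. {V i, V ((i + 1) mod 7)}" and ?w = "\<lambda>i. {U i, V i}"
  let ?A = "\<lambda>f. {i. i < 7 \<and> f i \<in> N}"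
  have fin: "finite (edges P71)" by (simp add: edges_P71)
  have inj: "inj_on ?u (?A ?u)" "inj_on ?v (?A ?v)" "inj_on ?w (?A ?w)"
    by (auto simp: inj_on_def doubleton_eq_iff mod_if split: if_splits)
  have "N = ?u ` ?A ?u \<union> ?v ` ?A ?v \<union> ?w ` ?A ?w"
    using assms by (auto simp: edges_P71)
  moreover have "card (?u ` ?A ?u \<union> ?v ` ?A ?v \<union> ?w ` ?A ?w) = card (?A ?u) + card (?A ?v) + card (?A ?w)"
    using inj by (subst card_Un_disjoint; (subst card_Un_disjoint)?) (auto simp: card_image doubleton_eq_iff)
  moreover have "card (?A f) = (\<Sum>i<7. of_bool (f i \<in> N))" for f :: "nat \<Rightarrow> vertex set"
    by (simp add: Collect_conj_eq lessThan_def[symmetric])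
  moreover have "total_size (columns N) =
      (\<Sum>i<7. of_bool (?u i \<in> N)) + (\<Sum>i<7. of_bool (?v i \<in> N)) + (\<Sum>i<7. of_bool (?w i \<in> N))"
    by (simp add: total_size_def columns_def column_size_def o_def
        interv_sum_list_conv_sum_set_nat atLeast0LessThan sum.distrib)
  ultimately have c: "card N = total_size (columns N)" by simp
  show ?thesis
    using c fin assms pairwise_disjnt_iff[OF assms] unfolding matching_of_size_def by (auto dest: finite_subset)
qed

section \<open>Switching on words\<close>

text \<open>An edge is flipped iff the indicator bits at its two ends differ. The far end of a rim
  edge lies in the next column, which \<open>rotate1\<close> supplies.\<close>

lemma columns_switch:
  assumes "length xs = 7"
  defines "X \<equiv> {U i | i. i < 7 \<and> fst (xs ! i)} \<union> {V i | i. i < 7 \<and> snd (xs ! i)}"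
  shows "columns (sym_diff M {e \<in> edges P71. odd (card (e \<inter> X))}) = switch xs (columns M)"
proof (rule nth_equalityI)
  fix i assume "i < length (columns (sym_diff M {e \<in> edges P71. odd (card (e \<inter> X))}))"
  then have i: "i < 7" by (simp add: columns_def)
  let ?j = "Suc i mod 7"
  have "i \<noteq> ?j" using i by (cases "i = 6") auto
  then have "odd (card ({U i, U ?j} \<inter> X)) \<longleftrightarrow> (fst (xs ! i)) \<noteq> (fst (xs ! ?j))"
    "odd (card ({V i, V ?j} \<inter> X)) \<longleftrightarrow> (snd (xs ! i)) \<noteq> (snd (xs ! ?j))"
    "odd (card ({U i, V i} \<inter> X)) \<longleftrightarrow> (fst (xs ! i)) \<noteq> (snd (xs ! i))"
    using i by (simp_all add: odd_card_doubleton_Int X_def)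
  moreover have "{U i, U ?j} \<in> edges P71" "{V i, V ?j} \<in> edges P71" "{U i, V i} \<in> edges P71"
    using i by (auto simp: edges_P71)
  moreover have "rotate1 xs ! i = xs ! ?j" using i assms by (simp add: nth_rotate1)
  moreover have "rotate1 xs \<noteq> []" "length xs = 7" using assms by auto
  ultimately show "columns (sym_diff M {e \<in> edges P71. odd (card (e \<inter> X))}) ! i = switch xs (columns M) ! i"
    using i by (auto simp: nth_columns switch_def case_prod_beta)
qed (use assms in \<open>simp add: columns_def switch_def\<close>)

lemma reducible_columns:
  assumes "M \<subseteq> edges P71" "reducible (columns M)"
  shows "\<exists>N k. k \<le> 4 \<and> matching_of_size P71 k N \<and> switching_equivalent P71 M N"
proof -
  obtain xs where xs: "length xs = 7" "reduced_by (columns M) xs"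
    using assms by (auto simp: reducible_def)
  define X where "X = {U i | i. i < 7 \<and> fst (xs ! i)} \<union> {V i | i. i < 7 \<and> snd (xs ! i)}"
  define N where "N = sym_diff M {e \<in> edges P71. odd (card (e \<inter> X))}"
  have X: "X \<subseteq> verts P71" by (auto simp: X_def P71_def)
  have "finite (verts P71)" by (simp add: P71_def)
  then have "finite X" using X finite_subset by blast
  have N: "N \<subseteq> edges P71" using assms(1) by (auto simp: N_def)
  have "columns N = switch xs (columns M)"
    using columns_switch[OF xs(1)] by (simp add: N_def X_def)
  then have "total_size (columns N) \<le> 4" "cyclic_compatible (columns N)"
    using xs(2) by (auto simp: reduced_by_def split: if_splits)
  moreover have "switching_equivalent P71 M N"
    using switch_set[OF \<open>finite X\<close> X] assms(1) N by (simp add: switching_equivalent_def signature_def N_def)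
  ultimately show ?thesis using matching_of_size_iff[OF N] by blast
qed

section \<open>Invariance under rotation\<close>

lemma rotate1_zip: "length xs = length ys \<Longrightarrow> rotate1 (zip xs ys) = zip (rotate1 xs) (rotate1 ys)"
  by (cases xs; cases ys) auto

lemma switch_rotate1:
  "length xs = length cs \<Longrightarrow> switch (rotate1 xs) (rotate1 cs) = rotate1 (switch xs cs)"
  by (simp add: switch_def rotate1_zip rotate1_map)

lemma cyclic_compatible_rotate1: "cyclic_compatible (rotate1 cs) = cyclic_compatible cs"
proof (cases cs)
  case (Cons c ds)
  then show ?thesis
    by (cases ds) (auto simp: cyclic_compatible_def successively_append_iff simp del: append_Cons)
qed simp

lemma total_size_rotate1: "total_size (rotate1 cs) = total_size cs"
  by (cases cs) (simp_all add: total_size_def)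

lemma reducible_rotate1:
  assumes "reducible (rotate1 cs)"
  shows "reducible cs"
proof -
  obtain xs where xs: "length xs = length cs" "reduced_by (rotate1 cs) xs"
    using assms by (auto simp: reducible_def)
  \<comment> \<open>Rotation is surjective on lists, so the switching set for the rotated word can
    be rotated back.\<close>
  obtain ys where ys: "xs = rotate1 ys" "length ys = length cs"
    by (metis xs(1) length_rotate1 surj_rotate1 surjD)
  then have "reduced_by cs ys"
    using xs(2)
    by (auto simp: reduced_by_def switch_rotate1 cyclic_compatible_rotate1 total_size_rotate1 split: if_splits)
  then show ?thesis using ys reducible_def by blast
qed

section \<open>Enumeration of words with a maximal first column\<close>

text \<open>Chosen among the orderings of the column types to leave few words with a maximal first column.\<close>

definition weight :: "column \<Rightarrow> nat" where
  "weight = (\<lambda>(a, b, s). 2 * of_bool a + of_bool b)"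

definition valid_columns :: "column list" where
  "valid_columns = [(False, False, False), (True, False, False), (False, True, False),
     (True, True, False), (False, False, True)]"

text \<open>Words of length \<open>n\<close> that may follow \<open>c\<close>, with exactly
  \<open>k\<close> edges left to place and all weights at most \<open>w\<close>. The guard
  \<open>column_size d \<le> k\<close> keeps the truncated subtraction honest.\<close>

fun extensions :: "nat \<Rightarrow> nat \<Rightarrow> column \<Rightarrow> nat \<Rightarrow> column list list" where
  "extensions w k c 0 = (if k = 0 then [[]] else [])"
| "extensions w k c (Suc n) = concat (map (\<lambda>d.
     if compatible c d \<and> weight d \<le> w \<and> column_size d \<le> k
     then map ((#) d) (extensions w (k - column_size d) d n) else []) valid_columns)"

text \<open>A spoke in \<open>d\<close> excludes the rim edges of \<open>d\<close> itself, which
  leaves five of the eight bit patterns.\<close>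

lemma compatible_valid_columns: "compatible c d \<Longrightarrow> d \<in> set valid_columns"
  by (cases c; cases d) (auto simp: compatible_def valid_columns_def)

lemma mem_extensions:
  assumes "successively compatible (c # ds)" "\<forall>d\<in>set ds. weight d \<le> w"
  shows "ds \<in> set (extensions w (total_size ds) c (length ds))"
  using assms
proof (induction ds arbitrary: c)
  case Nil
  then show ?case by (simp add: total_size_def)
next
  case (Cons d ds)
  then have "ds \<in> set (extensions w (total_size ds) d (length ds))"
    by simp
  then show ?case
    using Cons.prems compatible_valid_columns[of c d] by (auto simp: total_size_def intro!: bexI[of _ d])
qed

text \<open>The extensions respect only consecutive pairs; the filter adds the pair formed by the
  last and the first column.\<close>

definition anchored :: "column list list" where
  "anchored = filter cyclic_compatible (concat (map (\<lambda>c.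
     map ((#) c) (extensions (weight c) (5 - column_size c) c 6)) valid_columns))"

lemma mem_anchored:
  assumes "length cs = 7" "cyclic_compatible cs" "total_size cs = 5" "\<forall>d\<in>set cs. weight d \<le> weight (hd cs)"
  shows "cs \<in> set anchored"
proof -
  obtain c ds where cs: "cs = c # ds" "length ds = 6"
    using assms(1) by (cases cs) auto
  have s: "successively compatible (c # ds @ [c])"
    using assms(2) cs by (simp add: cyclic_compatible_def)
  then have "successively compatible (c # ds)"
    using successively_append_iff[of compatible "c # ds" "[c]"] by simp
  moreover have size: "5 - column_size c = total_size ds"
    using assms(3) cs by (auto simp: total_size_def)
  ultimately have "ds \<in> set (extensions (weight c) (5 - column_size c) c 6)"
    using mem_extensions[of c ds "weight c"] assms(4) cs size by simp
  \<comment> \<open>Cyclically the first column follows the last one, so it too is one of the five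
    valid patterns.\<close>
  moreover have "compatible (last (c # ds)) c"
    using s successively_append_iff[of compatible "c # ds" "[c]"] by simp
  ultimately show ?thesis
    using compatible_valid_columns[of "last (c # ds)" c] assms(2) cs
    unfolding anchored_def by (auto intro!: bexI[of _ c] simp del: last.simps)
qed

section \<open>The finite check\<close>

text \<open>Found by a greedy search over all vertex sets, most frequently successful sets first.\<close>

definition switching_sets :: "vertex list list" where
  "switching_sets = [
    [U 0, U 6, V 0], [U 1, U 2, U 3, U 4, U 5, V 1, V 2, V 3, V 4, V 5], [U 1, U 2, V 1],
    [U 0, U 1, U 2, U 3, U 4, U 5, U 6], [U 1, U 2, V 1, V 2], [U 1, V 0, V 1], [U 0, U 5, U 6],
    [V 2, V 3, V 4], [U 0, U 4, U 5, U 6, V 0], [U 1, U 2, U 3, V 1, V 2, V 3, V 4],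
    [U 0, U 1, U 2, U 3, U 4, U 5, U 6, V 0, V 1, V 2, V 3],
    [U 1, U 2, U 3, U 4, V 1, V 2, V 3, V 4, V 5], [U 1, U 2, U 3, U 4, V 1, V 2, V 3, V 4],
    [U 1, U 2, V 0, V 1], [U 1, U 2, U 3, U 4, V 1], [U 1, U 2, U 3, V 1, V 2, V 3],
    [U 1, U 2, U 3, V 1, V 2], [U 3, U 4, U 5], [U 1, V 0, V 1, V 2, V 3],
    [U 0, U 4, U 5, U 6, V 2, V 3, V 4], [U 0, U 1, U 2, U 3, U 4, U 5, U 6, V 1, V 4],
    [U 1, U 2, U 3, V 0, V 1, V 2, V 3, V 4], [U 1, V 1, V 2, V 3, V 4, V 5],
    [U 1, U 2, U 3, U 5, V 2, V 3, V 5], [U 1, U 2, U 3, U 4, V 1, V 2, V 3],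
    [U 0, U 1, U 2, U 3, U 4, U 5, U 6, V 1], [U 0, U 5, U 6, V 3, V 4],
    [U 0, U 3, U 4, V 0, V 4], [U 0, U 1, U 2, U 6, V 1, V 2, V 3, V 4, V 5]]"

definition indicator_columns :: "vertex list \<Rightarrow> (bool \<times> bool) list" where
  "indicator_columns X = map (\<lambda>i. (U i \<in> set X, V i \<in> set X)) [0..<7]"

definition reduced :: "column list \<Rightarrow> bool" where
  "reduced cs \<longleftrightarrow> find (reduced_by cs) (map indicator_columns switching_sets) \<noteq> None"

text \<open>The whole case analysis: for each word the sets are tried in order until one yields a
  matching with at most 4 edges.\<close>

lemma anchored_reduced: "list_all reduced anchored"
  by code_simp

lemma anchored_reducible:
  assumes "cs \<in> set anchored" "length cs = 7"
  shows "reducible cs"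
proof -
  obtain X where "reduced_by cs (indicator_columns X)"
    using anchored_reduced assms(1) by (auto simp: reduced_def list_all_iff find_None_iff)
  then show ?thesis
    using assms(2) by (auto simp: reducible_def indicator_columns_def intro!: exI)
qed

section \<open>Reduction to the enumerated words\<close>

text \<open>Rotating a column of maximal weight to the front gives an enumerated word, and
  reducibility passes back along the rotation.\<close>

lemma cyclic_compatible_reducible:
  assumes "length cs = 7" "cyclic_compatible cs" "total_size cs = 5"
  shows "reducible cs"
proof -
  have "finite (set cs)" "set cs \<noteq> {}" using assms(1) by auto
  then obtain c where "c \<in> set cs" "Max (weight ` set cs) = weight c"
    by (rule obtains_MAX)
  then have c: "c \<in> set cs" "\<forall>d\<in>set cs. weight d \<le> weight c"
    using Max_ge[of "weight ` set cs"] by auto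
  then obtain i where i: "i < 7" "cs ! i = c" using assms(1) by (auto simp: in_set_conv_nth)
  have inv: "cyclic_compatible (rotate n cs) \<and> total_size (rotate n cs) = 5
      \<and> (reducible (rotate n cs) \<longrightarrow> reducible cs)" for n
  proof (induction n)
    case (Suc n)
    then show ?case
      using reducible_rotate1[of "rotate n cs"] by (simp add: cyclic_compatible_rotate1 total_size_rotate1)
  qed (use assms in simp)
  have "hd (rotate i cs) = c"
    using i assms(1) by (subst hd_rotate_conv_nth) auto
  then have "rotate i cs \<in> set anchored"
    using c inv[of i] assms(1) by (intro mem_anchored) simp_all
  then show ?thesis
    using anchored_reducible[of "rotate i cs"] inv[of i] assms(1) by simp
qed

theorem theorem8:
  fixes M :: "vertex set set"
  assumes "matching_of_size P71 5 M"
  shows "\<exists>N k. k \<le> 4 \<and> matching_of_size P71 k N \<and> switching_equivalent P71 M N"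
proof -
  have M: "M \<subseteq> edges P71" using assms by (simp add: matching_of_size_def)
  have "reducible (columns M)"
    using assms matching_of_size_iff[OF M] by (intro cyclic_compatible_reducible) simp_all
  with M show ?thesis by (rule reducible_columns)
qed

end
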